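(* Let $n\ge2$ and $m\ge1$ be integers, let $s\in\mathbb{R}^n$ have pairwise distinct components, and let $o\in\Lambda(s)$ be an arbitrary fixed vector (the origin). Let $A$ be chosen uniformly at random from the set $S$ of matrices in $\{0,1\}^{m\times n^2}$ in which every row contains exactly two ones. For $w\in\{1,\dots,n\}$ let $L_w(A)$ be the number of codewords $x$ of $\Lambda(\theta(A),0,\unlhd,s)$, with $\unlhd=(=,\dots,=)$, such that $w_H(x)=w$. Then for every $w\in\{1,\dots,n\}$ $$\mathsf{E}[L_w(A)]=\binom nw\left\lfloor\frac{w!+1}{e}\right\rfloor\left(\frac{\binom n2+\binom{n^2-n}2}{\binom{n^2}2}\right)^m .$$
   Context: $\Pi_n$ is the set of $n\times n$ permutation matrices; $\Lambda(s)=\{Xs : X\in\Pi_n\}$; $\mathrm{vec}(X)\in\mathbb{R}^{n^2}$ is the row-by-row vectorization of $X$. The map $\theta:S\to\{-1,0,1\}^{m\times n^2}$ flips the sign of the first nonzero entry in each row: $B=\theta(A)$ has $B_{i,j}=-A_{i,j}$ if $A_{i,j'}=0$ for all $j'<j$, and $B_{i,j}=A_{i,j}$ otherwise. The code is $\Lambda(\theta(A),0,\unlhd,s)=\{Xs : X\in\Pi_n,\ \theta(A)\,\mathrm{vec}(X)=0\}$. The Hamming weight relative to the origin $o=(o_1,\dots,o_n)$ is $w_H(x)=|\{i\in\{1,\dots,n\} : x_i\ne o_i\}|$. The origin $o$ need not belong to the code. Each matrix in $S$ has probability $P(A)=\binom{n^2}{2}^{-m}$, and $\mathsf{E}$ is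 expectation with respect to $P$. Here $e$ is the base of natural logarithms. *)

theory Defs
  imports "HOL-Probability.Probability_Mass_Function" "Jordan_Normal_Form.Matrix"
begin

hide_type (open) Finite_Cartesian_Product.vec
hide_const (open) Finite_Cartesian_Product.vec
no_notation Finite_Cartesian_Product.vec_nth (infixl "$" 90)

definition perm_mats :: "nat \<Rightarrow> real mat set" where
  "perm_mats n = {X \<in> carrier_mat n n.
     (\<forall>i<n. \<forall>j<n. X $$ (i, j) \<in> {0, 1}) \<and>
     (\<forall>i<n. \<exists>!j. j < n \<and> X $$ (i, j) = 1) \<and>
     (\<forall>j<n. \<exists>!i. i < n \<and> X $$ (i, j) = 1)}"

definition perm_vecs :: "real vec \<Rightarrow> real vec set" where
  "perm_vecs s = {X *\<^sub>v s | X. X \<in> perm_mats (dim_vec s)}"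

definition vec_of_mat :: "real mat \<Rightarrow> real vec" where
  "vec_of_mat X = vec (dim_row X * dim_col X) (\<lambda>k. X $$ (k div dim_col X, k mod dim_col X))"

definition two_ones_mats :: "nat \<Rightarrow> nat \<Rightarrow> real mat set" where
  "two_ones_mats m N = {A \<in> carrier_mat m N.
     (\<forall>i<m. \<forall>j<N. A $$ (i, j) \<in> {0, 1}) \<and>
     (\<forall>i<m. card {j. j < N \<and> A $$ (i, j) = 1} = 2)}"

lemma card_two_ones_mats: "card (two_ones_mats m N) = (N choose 2) ^ m"
proof -
  let ?T = "{T. T \<subseteq> {..<N} \<and> card T = 2}"
  let ?f = "\<lambda>A :: real mat. \<lambda>i\<in>{..<m}. {j. j < N \<and> A $$ (i, j) = 1}"
  let ?g = "\<lambda>F. mat m N (\<lambda>(i, j). if j \<in> F i then 1 else 0 :: real)"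
  have "bij_betw ?f (two_ones_mats m N) (PiE {..<m} (\<lambda>_. ?T))"
  proof (rule bij_betw_byWitness[where f' = ?g])
    show "\<forall>A\<in>two_ones_mats m N. ?g (?f A) = A"
    proof
      fix A assume "A \<in> two_ones_mats m N"
      then have A: "A \<in> carrier_mat m N" and
        "\<And>i j. i < m \<Longrightarrow> j < N \<Longrightarrow> A $$ (i, j) = 0 \<or> A $$ (i, j) = 1"
        by (auto simp: two_ones_mats_def)
      then show "?g (?f A) = A"
        by (intro eq_matI) force+
    qed
    show "\<forall>F\<in>PiE {..<m} (\<lambda>_. ?T). ?f (?g F) = F"
    proof
      fix F assume F: "F \<in> PiE {..<m} (\<lambda>_. ?T)"
      show "?f (?g F) = F"
      proof
        fix i
        show "?f (?g F) i = F i"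
        proof (cases "i < m")
          case True
          then have "F i \<subseteq> {..<N}" using F by (auto simp: PiE_def Pi_def)
          with True show ?thesis by (auto split: if_splits)
        next
          case False
          with F show ?thesis by (auto simp: PiE_def extensional_def)
        qed
      qed
    qed
    show "?f ` two_ones_mats m N \<subseteq> PiE {..<m} (\<lambda>_. ?T)"
      by (auto simp: two_ones_mats_def)
    show "?g ` PiE {..<m} (\<lambda>_. ?T) \<subseteq> two_ones_mats m N"
    proof
      fix A assume "A \<in> ?g ` PiE {..<m} (\<lambda>_. ?T)"
      then obtain F where F: "F \<in> PiE {..<m} (\<lambda>_. ?T)" and A: "A = ?g F" by blast
      have "card {j. j < N \<and> A $$ (i, j) = 1} = 2" if "i < m" for i
      proof -
        have Fi: "F i \<subseteq> {..<N}" "card (F i) = 2" using F that by (auto simp: PiE_def Pi_def)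
        have "{j. j < N \<and> A $$ (i, j) = 1} = F i" using Fi(1) that by (auto simp: A split: if_splits)
        with Fi(2) show ?thesis by simp
      qed
      then show "A \<in> two_ones_mats m N" by (auto simp: two_ones_mats_def A)
    qed
  qed
  then have "card (two_ones_mats m N) = card (PiE {..<m} (\<lambda>_. ?T))"
    by (rule bij_betw_same_card)
  also have "\<dots> = (N choose 2) ^ m"
    by (simp add: card_PiE n_subsets)
  finally show ?thesis .
qed

lemma pmf_two_ones_mats:
  assumes "A \<in> two_ones_mats m N" and "N \<ge> 2"
  shows "pmf (pmf_of_set (two_ones_mats m N)) A = 1 / real (N choose 2) ^ m"
proof -
  have "N choose 2 > 0" using assms(2) by (simp add: zero_less_binomial)
  then have "card (two_ones_mats m N) > 0" by (simp add: card_two_ones_mats)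
  then have "finite (two_ones_mats m N)" "two_ones_mats m N \<noteq> {}"
    using card_gt_0_iff by blast+
  then show ?thesis using assms(1) by (simp add: pmf_of_set card_two_ones_mats)
qed

text \<open>Leading zeros also satisfy the guard, but negating them has no effect.\<close>

definition theta :: "real mat \<Rightarrow> real mat" where
  "theta A = mat (dim_row A) (dim_col A)
     (\<lambda>(i, j). if \<forall>j'<j. A $$ (i, j') = 0 then - A $$ (i, j) else A $$ (i, j))"

text \<open>The code given by constraint matrix B with zero right-hand side and all relations being equality.\<close>

definition perm_code :: "real mat \<Rightarrow> real vec \<Rightarrow> real vec set" where
  "perm_code B s = {X *\<^sub>v s | X. X \<in> perm_mats (dim_vec s) \<and>
     B *\<^sub>v vec_of_mat X = 0\<^sub>v (dim_row B)}"

definition hamming_weight :: "real vec \<Rightarrow> real vec \<Rightarrow> nat" where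
  "hamming_weight orig x = card {i. i < dim_vec orig \<and> x $ i \<noteq> orig $ i}"

definition num_codewords :: "real vec \<Rightarrow> real vec \<Rightarrow> nat \<Rightarrow> real mat \<Rightarrow> nat" where
  "num_codewords s orig w A = card {x \<in> perm_code (theta A) s. hamming_weight orig x = w}"

end

theory Submission
  imports Defs "HOL-Combinatorics.Permutations" "HOL-Computational_Algebra.Formal_Power_Series"
begin

text \<open>
  Codewords \<open>X s\<close> correspond to permutations \<open>p\<close>, and the weight of a codeword is the number of
  positions where \<open>p\<close> differs from the permutation of the origin; hence there are
  \<open>n choose w\<close> times \<open>D w\<close> candidates of weight \<open>w\<close>, with \<open>D w\<close> the number of derangements.
  The equation \<open>\<Sum>k. (n choose k) * D k = n!\<close> is inverted with exponential generating functions, and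
  the Leibniz criterion for the series of \<open>exp (-1)\<close> turns the result into the floor expression.
  A row of \<open>theta A\<close> with ones of \<open>A\<close> at two positions annihilates \<open>vec X\<close> iff \<open>vec X\<close>
  agrees at these positions. As \<open>vec X\<close> has \<open>n\<close> ones and \<open>n\<^sup>2 - n\<close> zeros and the rows are
  independent, each candidate survives with the same probability, and linearity of expectation
  finishes the proof.
\<close>

section \<open>Derangements\<close>

definition derangements :: "'a set \<Rightarrow> ('a \<Rightarrow> 'a) set" where
  "derangements A = {p. p permutes A \<and> (\<forall>x\<in>A. p x \<noteq> x)}"

lemma card_derangements_cong:
  assumes "finite A" "finite B" "card A = card B"
  shows "card (derangements A) = card (derangements B)"
proof -
  obtain f where "bij_betw f A B"
    using assms finite_same_card_bij by blast
  then show ?thesis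
    unfolding derangements_def by (rule bij_betw_same_card[OF bij_betw_derangements])
qed

text \<open>\<open>permutes\<close> forces the identity outside its set, so a derangement of
  \<open>T\<close> is literally the same function as a permutation of \<open>A\<close> moving
  exactly the points of \<open>T\<close>.\<close>

lemma derangements_eq_moved:
  assumes "T \<subseteq> A"
  shows "derangements T = {p. p permutes A \<and> {x\<in>A. p x \<noteq> x} = T}"
proof (intro equalityI subsetI)
  fix p assume "p \<in> derangements T"
  then have p: "p permutes T" "\<forall>x\<in>T. p x \<noteq> x" by (auto simp: derangements_def)
  have "p permutes A" using permutes_subset[OF p(1) assms] .
  with p assms show "p \<in> {p. p permutes A \<and> {x\<in>A. p x \<noteq> x} = T}"
    by (auto dest: permutes_not_in)
next
  fix p assume "p \<in> {p. p permutes A \<and> {x\<in>A. p x \<noteq> x} = T}"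
  then have p: "p permutes A" "{x\<in>A. p x \<noteq> x} = T" by auto
  have "p permutes T"
    by (rule permutes_superset[OF p(1)]) (use p(2) in auto)
  with p(2) show "p \<in> derangements T" by (auto simp: derangements_def)
qed

text \<open>Split by the set \<open>T\<close> of moved points. Classes of different \<open>T\<close>
  are disjoint, and each is as large as the set of derangements of \<open>{..<w}\<close>.\<close>

lemma card_permutes_moved:
  assumes "finite A"
  shows "card {p. p permutes A \<and> card {x\<in>A. p x \<noteq> x} = w} =
         (card A choose w) * card (derangements {..<w})"
proof -
  let ?\<T> = "{T. T \<subseteq> A \<and> card T = w}"
  let ?D = "\<lambda>T. {p. p permutes A \<and> {x\<in>A. p x \<noteq> x} = T}"
  have "card {p. p permutes A \<and> card {x\<in>A. p x \<noteq> x} = w} = card (\<Union>T\<in>?\<T>. ?D T)"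
    by (rule arg_cong[where f = card]) auto
  also have "\<dots> = (\<Sum>T\<in>?\<T>. card (?D T))"
    using assms
    by (intro card_UN_disjoint) (auto intro: finite_subset[OF _ finite_permutations[of A]])
  also have "\<dots> = (\<Sum>T\<in>?\<T>. card (derangements T))"
    by (intro sum.cong refl arg_cong[where f = card] derangements_eq_moved[symmetric]) auto
  also have "\<dots> = (\<Sum>T\<in>?\<T>. card (derangements {..<w}))"
    using assms by (intro sum.cong refl card_derangements_cong) (auto intro: finite_subset)
  also have "\<dots> = (card A choose w) * card (derangements {..<w})"
    using assms by (simp add: n_subsets)
  finally show ?thesis .
qed

text \<open>Sorting all permutations by their number of moved points yields the binomial convolution
  that is inverted next.\<close>

lemma sum_choose_derangements:
  "(\<Sum>k\<le>n. (n choose k) * card (derangements {..<k})) = fact n"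
proof -
  let ?A = "{..<n}" and ?m = "\<lambda>p :: nat \<Rightarrow> nat. card {x\<in>{..<n}. p x \<noteq> x}"
  have "fact n = card {p. p permutes ?A}"
    by (simp add: card_permutations)
  also have "{p. p permutes ?A} = (\<Union>k\<le>n. {p. p permutes ?A \<and> ?m p = k})"
  proof -
    have "?m p \<le> n" for p
      using card_mono[of "{..<n}" "{x\<in>{..<n}. p x \<noteq> x}"] by auto
    then show ?thesis by auto
  qed
  also have "card \<dots> = (\<Sum>k\<le>n. card {p. p permutes ?A \<and> ?m p = k})"
    by (rule card_UN_disjoint) (auto intro: finite_subset[OF _ finite_permutations[of ?A]])
  also have "\<dots> = (\<Sum>k\<le>n. (n choose k) * card (derangements {..<k}))"
    by (simp only: card_permutes_moved finite_lessThan card_lessThan)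
  finally show ?thesis by simp
qed

section \<open>Closed formulas for the derangement numbers\<close>

text \<open>After division by \<open>fact n\<close>, the convolution says F(x) exp(x) = 1/(1 - x),
  where F is the exponential generating function of the derangement numbers. Hence F(x) = exp(-x)/(1
  - x), and division by 1 - x turns coefficients into partial sums.\<close>

lemma card_derangements_alternating_sum:
  "real (card (derangements {..<n})) = fact n * (\<Sum>k\<le>n. (-1) ^ k / fact k)"
proof -
  define F where "F = Abs_fps (\<lambda>k. real (card (derangements {..<k})) / fact k)"
  \<comment> \<open>\<open>G\<close> is 1/(1 - x), the exponential generating function of the
    factorials.\<close>
  define G :: "real fps" where "G = Abs_fps (\<lambda>_. 1)"
  have "F * fps_exp 1 = G"
  proof (rule fps_ext)
    fix n
    have "fps_nth (F * fps_exp 1) n =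
        (\<Sum>k\<le>n. real ((n choose k) * card (derangements {..<k})) / fact n)"
      by (simp add: F_def fps_mult_nth atLeast0AtMost binomial_fact)
    also have "\<dots> = real (\<Sum>k\<le>n. (n choose k) * card (derangements {..<k})) / fact n"
      by (simp only: of_nat_sum sum_divide_distrib)
    also have "\<dots> = fps_nth G n"
      by (simp add: sum_choose_derangements G_def)
    finally show "fps_nth (F * fps_exp 1) n = fps_nth G n" .
  qed
  moreover have "fps_exp 1 * fps_exp (-1 :: real) = 1"
    by (metis add.right_inverse fps_exp_0 fps_exp_add_mult)
  ultimately have "F = fps_exp (-1) * G"
    by (metis mult.assoc mult.commute mult.right_neutral)
  then have "fps_nth F n = fps_nth (fps_exp (-1) * G) n" by simp
  then have "real (card (derangements {..<n})) / fact n = (\<Sum>k\<le>n. (-1) ^ k / fact k)"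
    by (simp add: F_def G_def fps_mult_nth atLeast0AtMost)
  then show ?thesis by (simp add: divide_eq_eq mult.commute)
qed

text \<open>Let D be the number of derangements. Then n!/e differs from D by at most 1/(n + 1),
  below D for even n and above it for odd n. Adding 1/e puts the value into the interval [D, D + 1)
  in both cases. For n = 0 the formula fails: the empty set has one derangement, but the floor of
  2/e is 0.\<close>

lemma card_derangements:
  assumes "n \<ge> 1"
  shows "int (card (derangements {..<n})) = \<lfloor>(fact n + 1) / exp (1::real)\<rfloor>"
proof -
  \<comment> \<open>The last exponent in \<open>S n\<close> is n - 1, so D is
    \<open>fact n * S (Suc n)\<close>; sums of even index bound exp(-1) from below, those of odd
    index from above.\<close>
  define S :: "nat \<Rightarrow> real" where "S = (\<lambda>n. \<Sum>k<n. (-1) ^ k * inverse (fact k))"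
  let ?e = "exp (-1 :: real)"
  have e: "(\<Sum>k. (-1) ^ k * inverse (fact k)) = ?e"
    using exp_converges[of "-1 :: real"] by (simp add: sums_iff field_simps)
  have lim: "(\<lambda>k. inverse (fact k) :: real) \<longlonglongrightarrow> 0"
    using summable_LIMSEQ_zero[OF summable_exp[of "1::real"]] by simp
  have mono: "inverse (fact (Suc k)) \<le> (inverse (fact k) :: real)" for k
    by (intro le_imp_inverse_le fact_mono) auto
  have lower: "S (2 * k) \<le> ?e" for k
    using summable_Leibniz'(2)[OF lim _ mono, of k] by (simp add: S_def e)
  have upper: "?e \<le> S (2 * k + 1)" for k
    using summable_Leibniz'(4)[OF lim _ mono, of k] by (simp add: S_def e)
  have D: "real (card (derangements {..<n})) = fact n * S (Suc n)"
    by (simp add: card_derangements_alternating_sum S_def lessThan_Suc_atMost divide_inverse)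
  have next_term: "fact n * S (Suc (Suc n)) = fact n * S (Suc n) - (-1) ^ n / (real n + 1)"
  proof -
    have "S (Suc (Suc n)) = S (Suc n) - (-1) ^ n * inverse (fact (Suc n))"
      by (simp add: S_def del: fact_Suc)
    moreover have "fact n * inverse (fact (Suc n)) = 1 / (real n + 1)"
      by (simp add: inverse_eq_divide add.commute)
    ultimately show ?thesis
      by (simp add: right_diff_distrib mult.left_commute[of "fact n"] del: fact_Suc)
  qed
  have e_ge: "1 / 3 \<le> ?e"
    using exp_le by (simp add: exp_minus field_simps)
  \<comment> \<open>The linear bound gives only e >= 2; the quadratic Taylor bound e >= 5/2 makes
    the inequality strict.\<close>
  have e_less: "?e < 1 / 2"
    using exp_ge_add_one_self[of "1::real"] exp_gt_one[of "1::real"] exp_lower_Taylor_quadratic[of 1]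
    by (simp add: exp_minus field_simps)
  have "fact n * S (Suc n) \<le> (fact n + 1) * ?e \<and> (fact n + 1) * ?e < fact n * S (Suc n) + 1"
  proof (cases "even n")
    case True
    then obtain k where k: "n = 2 * k" by blast
    have "fact n * ?e \<le> fact n * S (Suc n)"
      using upper[of k] k by simp
    moreover have "fact n * S (Suc (Suc n)) \<le> fact n * ?e"
      using lower[of "Suc k"] k by simp
    \<comment> \<open>An even n >= 1 is at least 2, so the deficit is at most 1/3, which the added
      exp(-1) covers.\<close>
    moreover have "1 / (real n + 1) \<le> 1 / 3"
      using assms k by (simp add: field_simps)
    moreover have "fact n * S (Suc (Suc n)) = fact n * S (Suc n) - 1 / (real n + 1)"
      using next_term True by simp
    ultimately show ?thesis
      using e_ge e_less unfolding distrib_right by (intro conjI; linarith)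
  next
    case False
    then obtain k where k: "n = 2 * k + 1" by (elim oddE)
    have "fact n * S (Suc n) \<le> fact n * ?e"
      using lower[of "Suc k"] k by simp
    moreover have "fact n * ?e \<le> fact n * S (Suc (Suc n))"
      using upper[of "Suc k"] k by simp
    \<comment> \<open>Here n = 1 is possible, so the excess may reach 1/2; together with exp(-1) <
      1/2 it still stays below 1.\<close>
    moreover have "1 / (real n + 1) \<le> 1 / 2"
      using assms by (simp add: field_simps)
    moreover have "fact n * S (Suc (Suc n)) = fact n * S (Suc n) + 1 / (real n + 1)"
      using next_term False by simp
    ultimately show ?thesis
      using e_ge e_less unfolding distrib_right by (intro conjI; linarith)
  qed
  then have "\<lfloor>(fact n + 1) * ?e\<rfloor> = int (card (derangements {..<n}))"
    by (intro floor_unique) (simp_all add: D)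
  then show ?thesis by (simp add: exp_minus divide_inverse)
qed

section \<open>Permutation matrices\<close>

text \<open>Row \<open>i\<close> has its one in column \<open>p i\<close>, so the product with
  \<open>s\<close> is \<open>s\<close> read along \<open>p\<close> itself and not along its
  inverse.\<close>

definition perm_mat :: "nat \<Rightarrow> (nat \<Rightarrow> nat) \<Rightarrow> real mat" where
  "perm_mat n p = mat n n (\<lambda>(i, j). if j = p i then 1 else 0)"

lemma dim_perm_mat [simp]: "dim_row (perm_mat n p) = n" "dim_col (perm_mat n p) = n"
  by (simp_all add: perm_mat_def)

lemma perm_mat_mult_vec:
  assumes "p permutes {..<n}" "s \<in> carrier_vec n"
  shows "perm_mat n p *\<^sub>v s = vec n (\<lambda>i. s $ p i)"
proof (rule eq_vecI)
  fix i assume "i < dim_vec (vec n (\<lambda>i. s $ p i))"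
  then have i: "i < n" by simp
  then have "p i < n" using permutes_in_image[OF assms(1), of i] by simp
  then show "(perm_mat n p *\<^sub>v s) $ i = vec n (\<lambda>i. s $ p i) $ i"
    using i assms(2)
    by (simp add: perm_mat_def scalar_prod_def if_distrib[of "\<lambda>x. x * _"] cong: if_cong)
qed simp

lemma perm_mats_eq: "perm_mats n = perm_mat n ` {p. p permutes {..<n}}"
proof (intro subset_antisym subsetI)
  fix X assume "X \<in> perm_mats n"
  then have X: "X \<in> carrier_mat n n"
    and entries: "\<And>i j. i < n \<Longrightarrow> j < n \<Longrightarrow> X $$ (i, j) = 0 \<or> X $$ (i, j) = 1"
    and rows: "\<And>i. i < n \<Longrightarrow> \<exists>!j. j < n \<and> X $$ (i, j) = 1"
    and cols: "\<And>j. j < n \<Longrightarrow> \<exists>!i. i < n \<and> X $$ (i, j) = 1"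
    by (auto simp: perm_mats_def)
  \<comment> \<open>The identity outside \<open>{..<n}\<close> is what \<open>permutes\<close>
    demands.\<close>
  define p where "p = (\<lambda>i. if i < n then THE j. j < n \<and> X $$ (i, j) = 1 else i)"
  have p: "p i < n \<and> X $$ (i, p i) = 1" if "i < n" for i
    using theI'[OF rows[OF that]] that by (simp add: p_def)
  have p_unique: "j = p i" if "i < n" "j < n" "X $$ (i, j) = 1" for i j
    using rows[OF that(1)] p[OF that(1)] that by blast
  \<comment> \<open>Uniqueness of the one in each column gives injectivity, which suffices on a
    finite set.\<close>
  have "p permutes {..<n}"
  proof (rule inj_imp_permutes)
    show "inj_on p {..<n}"
    proof (rule inj_onI)
      fix i j assume ij: "i \<in> {..<n}" "j \<in> {..<n}" "p i = p j"
      then show "i = j" using cols[of "p i"] p[of i] p[of j] by auto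
    qed
  qed (use p in \<open>auto simp: p_def\<close>)
  moreover have "X = perm_mat n p"
  proof (rule eq_matI)
    fix i j assume "i < dim_row (perm_mat n p)" "j < dim_col (perm_mat n p)"
    then have ij: "i < n" "j < n" by simp_all
    show "X $$ (i, j) = perm_mat n p $$ (i, j)"
    proof (cases "j = p i")
      case True
      with p[OF ij(1)] ij show ?thesis by (simp add: perm_mat_def)
    next
      case False
      then have "X $$ (i, j) = 0" using entries[OF ij] p_unique[OF ij] by blast
      with False ij show ?thesis by (simp add: perm_mat_def)
    qed
  qed (use X in simp_all)
  ultimately show "X \<in> perm_mat n ` {p. p permutes {..<n}}" by blast
next
  fix X assume "X \<in> perm_mat n ` {p. p permutes {..<n}}"
  then obtain p where p: "p permutes {..<n}" and X: "X = perm_mat n p" by blast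
  have "\<exists>!j. j < n \<and> X $$ (i, j) = 1" if "i < n" for i
    using that permutes_in_image[OF p, of i] by (auto simp: X perm_mat_def split: if_splits)
  moreover have "\<exists>!i. i < n \<and> X $$ (i, j) = 1" if j: "j < n" for j
  proof -
    obtain i where i: "p i = j" "\<And>i'. p i' = j \<Longrightarrow> i' = i"
      using p unfolding permutes_def by metis
    have "i < n" using i(1) j permutes_in_image[OF p, of i] by simp
    show ?thesis
    proof (rule ex1I)
      show "i < n \<and> X $$ (i, j) = 1"
        using \<open>i < n\<close> j i(1) by (simp add: X perm_mat_def)
      show "i' = i" if "i' < n \<and> X $$ (i', j) = 1" for i'
        using that j i(2)[of i'] by (auto simp: X perm_mat_def split: if_splits)
    qed
  qed
  moreover have "X \<in> carrier_mat n n" "\<forall>i<n. \<forall>j<n. X $$ (i, j) \<in> {0, 1}"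
    by (simp_all add: X perm_mat_def)
  ultimately show "X \<in> perm_mats n" by (simp add: perm_mats_def)
qed

text \<open>In row-by-row order the one of row \<open>i\<close> lands at position
  \<open>i * n + p i\<close>, and division by \<open>n\<close> recovers the row.\<close>

lemma card_ones_vec_of_perm_mat:
  assumes "p permutes {..<n}"
  shows "card {k. k < n * n \<and> vec_of_mat (perm_mat n p) $ k = 1} = n"
proof -
  have p: "p i < n" if "i < n" for i
    using that permutes_in_image[OF assms, of i] by simp
  have less: "i * n + p i < n * n" if "i < n" for i
  proof -
    have "i * n + p i < Suc i * n" using p[OF that] by simp
    also have "\<dots> \<le> n * n" using that by (intro mult_right_mono) auto
    finally show ?thesis .
  qed
  have "bij_betw (\<lambda>i. i * n + p i) {..<n}
      {k. k < n * n \<and> vec_of_mat (perm_mat n p) $ k = 1}"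
  proof (rule bij_betw_byWitness[where f' = "\<lambda>k. k div n"])
    show "(\<lambda>i. i * n + p i) ` {..<n} \<subseteq> {k. k < n * n \<and> vec_of_mat (perm_mat n p) $ k = 1}"
      using p less by (auto simp: vec_of_mat_def perm_mat_def)
    show "\<forall>k\<in>{k. k < n * n \<and> vec_of_mat (perm_mat n p) $ k = 1}. k div n * n + p (k div n) = k"
    proof
      fix k assume k: "k \<in> {k. k < n * n \<and> vec_of_mat (perm_mat n p) $ k = 1}"
      then have "k div n < n" "n > 0" by (auto simp: less_mult_imp_div_less intro: gr0I)
      with k have "k mod n = p (k div n)"
        by (auto simp: vec_of_mat_def perm_mat_def split: if_splits)
      then show "k div n * n + p (k div n) = k"
        by (metis div_mult_mod_eq)
    qed
  qed (use p in \<open>auto simp: less_mult_imp_div_less\<close>)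
  then show ?thesis by (simp flip: bij_betw_same_card)
qed

section \<open>Random constraint matrices\<close>

abbreviation row_ones :: "nat \<Rightarrow> real mat \<Rightarrow> nat \<Rightarrow> nat set" where
  "row_ones N A i \<equiv> {j. j < N \<and> A $$ (i, j) = 1}"

text \<open>This is the independence of the rows: a matrix amounts to m free choices of a
  two-element set, and a condition imposed on every row separately restricts each choice in the same
  way.\<close>

lemma card_two_ones_mats_restricted:
  "card {A \<in> two_ones_mats m N. \<forall>i<m. P (row_ones N A i)} =
   card {T. T \<subseteq> {..<N} \<and> card T = 2 \<and> P T} ^ m"
proof -
  let ?T = "{T. T \<subseteq> {..<N} \<and> card T = 2 \<and> P T}"
  let ?S = "{A \<in> two_ones_mats m N. \<forall>i<m. P (row_ones N A i)}"
  \<comment> \<open>The restricted abstraction yields \<open>undefined\<close> outside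
    \<open>{..<m}\<close>, as membership in \<open>PiE\<close> requires.\<close>
  let ?f = "\<lambda>A. \<lambda>i\<in>{..<m}. row_ones N A i"
  let ?g = "\<lambda>F. mat m N (\<lambda>(i, j). if j \<in> F i then 1 else 0 :: real)"
  have row_g: "row_ones N (?g F) i = F i" if "F \<in> PiE {..<m} (\<lambda>_. ?T)" "i < m" for F i
  proof -
    have "F i \<subseteq> {..<N}" using that by (auto simp: PiE_def Pi_def)
    then show ?thesis using that(2) by (auto split: if_splits)
  qed
  have "bij_betw ?f ?S (PiE {..<m} (\<lambda>_. ?T))"
  proof (rule bij_betw_byWitness[where f' = ?g])
    show "\<forall>A\<in>?S. ?g (?f A) = A"
    proof
      fix A assume "A \<in> ?S"
      then have A: "A \<in> carrier_mat m N" and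
        "\<And>i j. i < m \<Longrightarrow> j < N \<Longrightarrow> A $$ (i, j) = 0 \<or> A $$ (i, j) = 1"
        by (auto simp: two_ones_mats_def)
      then show "?g (?f A) = A"
        by (intro eq_matI) force+
    qed
    show "\<forall>F\<in>PiE {..<m} (\<lambda>_. ?T). ?f (?g F) = F"
    proof
      fix F assume F: "F \<in> PiE {..<m} (\<lambda>_. ?T)"
      have "?f (?g F) i = F i" for i
        using row_g[OF F, of i] PiE_arb[OF F, of i] by (cases "i < m") simp_all
      then show "?f (?g F) = F" by blast
    qed
    show "?f ` ?S \<subseteq> PiE {..<m} (\<lambda>_. ?T)"
      by (auto simp: two_ones_mats_def)
    show "?g ` PiE {..<m} (\<lambda>_. ?T) \<subseteq> ?S"
    proof
      fix A assume "A \<in> ?g ` PiE {..<m} (\<lambda>_. ?T)"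
      then obtain F where F: "F \<in> PiE {..<m} (\<lambda>_. ?T)" and A: "A = ?g F" by blast
      have rows: "row_ones N A i = F i" if "i < m" for i
        unfolding A by (rule row_g[OF F that])
      have "card (row_ones N A i) = 2 \<and> P (row_ones N A i)" if "i < m" for i
        unfolding rows[OF that] using F that by (auto simp: PiE_def Pi_def)
      moreover have "A \<in> carrier_mat m N" "\<forall>i<m. \<forall>j<N. A $$ (i, j) \<in> {0, 1}"
        by (auto simp: A)
      ultimately show "A \<in> ?S" by (simp add: two_ones_mats_def)
    qed
  qed
  then have "card ?S = card (PiE {..<m} (\<lambda>_. ?T))"
    by (rule bij_betw_same_card)
  then show ?thesis by (simp add: card_PiE)
qed

text \<open>For a 0-1 vector, a pair of positions agrees iff it lies wholly among the ones or wholly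
  among the zeros.\<close>

lemma card_pairs_agreeing:
  fixes v :: "real vec"
  assumes "\<And>k. k < N \<Longrightarrow> v $ k \<in> {0, 1}" "card {k. k < N \<and> v $ k = 1} = K"
  shows "card {T. T \<subseteq> {..<N} \<and> card T = 2 \<and> (\<forall>a\<in>T. \<forall>b\<in>T. v $ a = v $ b)} =
         (K choose 2) + ((N - K) choose 2)"
proof -
  define U where "U = {k. k < N \<and> v $ k = 1}"
  have U: "U \<subseteq> {..<N}" "card U = K" using assms(2) by (auto simp: U_def)
  let ?\<P> = "\<lambda>A. {T. T \<subseteq> A \<and> card T = 2}"
  have agree_iff: "(\<forall>a\<in>T. \<forall>b\<in>T. v $ a = v $ b) \<longleftrightarrow> T \<subseteq> U \<or> T \<subseteq> {..<N} - U"
    if T: "T \<subseteq> {..<N}" for T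
  proof
    assume agree: "\<forall>a\<in>T. \<forall>b\<in>T. v $ a = v $ b"
    show "T \<subseteq> U \<or> T \<subseteq> {..<N} - U"
    proof (cases "T \<inter> U = {}")
      case True
      with T show ?thesis by blast
    next
      case False
      then obtain a where a: "a \<in> T" "v $ a = 1" by (auto simp: U_def)
      have "T \<subseteq> U"
      proof
        fix b assume b: "b \<in> T"
        have "v $ b = v $ a" using agree a(1) b by blast
        with a(2) b T show "b \<in> U" by (auto simp: U_def)
      qed
      then show ?thesis ..
    qed
  next
    assume "T \<subseteq> U \<or> T \<subseteq> {..<N} - U"
    then show "\<forall>a\<in>T. \<forall>b\<in>T. v $ a = v $ b"
    proof
      assume "T \<subseteq> U"
      then have "v $ a = 1" if "a \<in> T" for a using that by (auto simp: U_def)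
      then show ?thesis by simp
    next
      assume T_diff: "T \<subseteq> {..<N} - U"
      have "v $ a = 0" if "a \<in> T" for a
        using assms(1)[of a] subsetD[OF T_diff that] by (auto simp: U_def)
      then show ?thesis by simp
    qed
  qed
  have "{T. T \<subseteq> {..<N} \<and> card T = 2 \<and> (\<forall>a\<in>T. \<forall>b\<in>T. v $ a = v $ b)} =
      {T. T \<subseteq> {..<N} \<and> card T = 2 \<and> (T \<subseteq> U \<or> T \<subseteq> {..<N} - U)}"
    by (intro Collect_cong conj_cong refl agree_iff)
  also have "\<dots> = ?\<P> U \<union> ?\<P> ({..<N} - U)"
    using U(1) by blast
  finally have "{T. T \<subseteq> {..<N} \<and> card T = 2 \<and> (\<forall>a\<in>T. \<forall>b\<in>T. v $ a = v $ b)} =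
      ?\<P> U \<union> ?\<P> ({..<N} - U)" .
  \<comment> \<open>Only the empty set is contained in both parts, and it does not have two
    elements.\<close>
  moreover have "?\<P> U \<inter> ?\<P> ({..<N} - U) = {}"
  proof (rule equals0I)
    fix T assume "T \<in> ?\<P> U \<inter> ?\<P> ({..<N} - U)"
    then have "card T = 2" "T \<subseteq> U" "T \<subseteq> {..<N} - U" by simp_all
    then have "T = {}" by blast
    with \<open>card T = 2\<close> show False by simp
  qed
  moreover have "card ({..<N} - U) = N - K"
    using U by (simp add: card_Diff_subset finite_subset[OF U(1)])
  ultimately show ?thesis
    using U by (simp add: card_Un_disjoint n_subsets finite_subset[OF U(1)])
qed

text \<open>If a < b are the positions of the ones in a row of \<open>A\<close>, the row of
  \<open>theta A\<close> has -1 at a and 1 at b, so its product with \<open>v\<close> is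
  \<open>v $ b - v $ a\<close>.\<close>

lemma theta_mult_vec_eq_0_iff:
  assumes A: "A \<in> two_ones_mats m N" and v: "v \<in> carrier_vec N"
  shows "theta A *\<^sub>v v = 0\<^sub>v (dim_row (theta A)) \<longleftrightarrow>
    (\<forall>i<m. \<forall>a\<in>row_ones N A i. \<forall>b\<in>row_ones N A i. v $ a = v $ b)"
proof -
  have dim: "dim_row A = m" "dim_col A = N" using A by (auto simp: two_ones_mats_def)
  have row: "(theta A *\<^sub>v v) $ i = 0 \<longleftrightarrow>
      (\<forall>a\<in>row_ones N A i. \<forall>b\<in>row_ones N A i. v $ a = v $ b)" if i: "i < m" for i
  proof -
    have "card (row_ones N A i) = 2" using A i by (auto simp: two_ones_mats_def)
    then obtain c d where cd: "row_ones N A i = {c, d}" "c \<noteq> d"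
      unfolding card_2_iff by blast
    \<comment> \<open>The two positions must be ordered, since \<open>theta\<close> negates the
      first one.\<close>
    define a b where "a = min c d" and "b = max c d"
    have ab: "row_ones N A i = {a, b}" "a < b"
      using cd(2) unfolding cd(1) a_def b_def by (auto simp: min_def max_def)
    have "a \<in> row_ones N A i" "b \<in> row_ones N A i" unfolding ab(1) by simp_all
    then have "a < N" "b < N" "A $$ (i, a) = 1" "A $$ (i, b) = 1" by simp_all
    have zero: "A $$ (i, j) = 0" if "j < N" "j \<noteq> a" "j \<noteq> b" for j
    proof -
      have "A $$ (i, j) \<in> {0, 1}" using A i that(1) by (auto simp: two_ones_mats_def)
      moreover have "j \<notin> row_ones N A i" unfolding ab(1) using that by simp
      ultimately show ?thesis using that(1) by auto
    qed
    \<comment> \<open>The guard of \<open>theta\<close> holds exactly up to column \<open>a\<close>: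
      entries before \<open>a\<close> are zero and unaffected by negation, while the one at
      \<open>a\<close> blocks the guard at \<open>b\<close>.\<close>
    have theta: "theta A $$ (i, j) = (if j = a then -1 else if j = b then 1 else 0)"
      if "j < N" for j
      using that i zero ab(2) \<open>A $$ (i, a) = 1\<close> \<open>A $$ (i, b) = 1\<close> \<open>b < N\<close>
      by (auto simp: theta_def dim)
    have "(theta A *\<^sub>v v) $ i = (\<Sum>j\<in>{0..<N}. theta A $$ (i, j) * v $ j)"
      using i v by (auto simp: scalar_prod_def theta_def dim)
    also have "\<dots> = (\<Sum>j\<in>{0..<N}. (if j = a then - v $ j else 0) + (if j = b then v $ j else 0))"
      using ab(2) by (intro sum.cong refl) (auto simp: theta)
    also have "\<dots> = v $ b - v $ a"
      using \<open>a < N\<close> \<open>b < N\<close> by (simp add: sum.distrib)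
    finally show ?thesis unfolding ab(1) by auto
  qed
  have "dim_row (theta A) = m" by (simp add: theta_def dim)
  then show ?thesis using row by (auto simp: vec_eq_iff)
qed

text \<open>The count does not depend on \<open>p\<close>, because every vectorized permutation
  matrix has n ones among its n^2 entries. This is what makes the expectation a product.\<close>

lemma card_annihilating_mats:
  assumes p: "p permutes {..<n}"
  shows "card {A \<in> two_ones_mats m (n\<^sup>2).
           theta A *\<^sub>v vec_of_mat (perm_mat n p) = 0\<^sub>v (dim_row (theta A))} =
         ((n choose 2) + ((n\<^sup>2 - n) choose 2)) ^ m"
proof -
  let ?v = "vec_of_mat (perm_mat n p)"
  let ?agree = "\<lambda>T. \<forall>a\<in>T. \<forall>b\<in>T. ?v $ a = ?v $ b"
  have v: "?v \<in> carrier_vec (n\<^sup>2)"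
    unfolding vec_of_mat_def power2_eq_square dim_perm_mat by (rule vec_carrier)
  have bits: "?v $ k \<in> {0, 1}" if "k < n\<^sup>2" for k
  proof -
    have "k < n * n" using that by (simp add: power2_eq_square)
    then have "k div n < n" "n > 0" by (auto simp: less_mult_imp_div_less intro: gr0I)
    with \<open>k < n * n\<close> show ?thesis by (simp add: vec_of_mat_def perm_mat_def)
  qed
  have ones: "card {k. k < n\<^sup>2 \<and> ?v $ k = 1} = n"
    using card_ones_vec_of_perm_mat[OF p] unfolding power2_eq_square .
  have "{A \<in> two_ones_mats m (n\<^sup>2). theta A *\<^sub>v ?v = 0\<^sub>v (dim_row (theta A))} =
      {A \<in> two_ones_mats m (n\<^sup>2). \<forall>i<m. ?agree (row_ones (n\<^sup>2) A i)}"
    by (intro Collect_cong conj_cong refl theta_mult_vec_eq_0_iff[OF _ v])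
  then have "card {A \<in> two_ones_mats m (n\<^sup>2). theta A *\<^sub>v ?v = 0\<^sub>v (dim_row (theta A))} =
      card {T. T \<subseteq> {..<n\<^sup>2} \<and> card T = 2 \<and> ?agree T} ^ m"
    by (simp only: card_two_ones_mats_restricted[where P = ?agree])
  then show ?thesis
    by (simp only: card_pairs_agreeing[OF bits ones])
qed

section \<open>Codewords of given weight\<close>

text \<open>Composing with the inverse of \<open>q\<close> on the left turns the points where
  \<open>p\<close> and \<open>q\<close> differ into moved points.\<close>

lemma card_permutes_differing:
  assumes "finite A" "q permutes A"
  shows "card {p. p permutes A \<and> card {x\<in>A. p x \<noteq> q x} = w} =
         (card A choose w) * card (derangements {..<w})"
proof -
  have "bij_betw ((\<circ>) (Hilbert_Choice.inv q)) {p. p permutes A \<and> card {x\<in>A. p x \<noteq> q x} = w}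
      {p. p permutes A \<and> card {x\<in>A. p x \<noteq> x} = w}"
  proof (rule bij_betw_byWitness[where f' = "(\<circ>) q"])
    have "Hilbert_Choice.inv q y \<noteq> x \<longleftrightarrow> y \<noteq> q x" for x y
      using permutes_inv_eq[OF assms(2)] by metis
    then show "(\<circ>) (Hilbert_Choice.inv q) ` {p. p permutes A \<and> card {x\<in>A. p x \<noteq> q x} = w} \<subseteq>
        {p. p permutes A \<and> card {x\<in>A. p x \<noteq> x} = w}"
      using permutes_compose[OF _ permutes_inv[OF assms(2)]] by auto
    have "q y \<noteq> q x \<longleftrightarrow> y \<noteq> x" for x y
      using permutes_inj[OF assms(2)] by (auto dest: injD)
    then show "(\<circ>) q ` {p. p permutes A \<and> card {x\<in>A. p x \<noteq> x} = w} \<subseteq>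
        {p. p permutes A \<and> card {x\<in>A. p x \<noteq> q x} = w}"
      using permutes_compose[OF _ assms(2)] by auto
  qed (auto simp: fun_eq_iff permutes_inverses[OF assms(2)])
  from bij_betw_same_card[OF this] show ?thesis
    by (simp only: card_permutes_moved[OF assms(1)])
qed

text \<open>Distinct components of \<open>s\<close> make a coordinate of the codeword determine the
  value of \<open>p\<close> there. So distinct permutations give distinct codewords, and the weight
  counts disagreements with \<open>q\<close>. The permutation and weight conditions are bracketed
  together because they do not involve \<open>A\<close>: the set is a filter of a fixed set of
  candidates.\<close>

lemma num_codewords_eq_card_permutes:
  assumes s: "s \<in> carrier_vec n" and distinct: "\<forall>i<n. \<forall>j<n. i \<noteq> j \<longrightarrow> s $ i \<noteq> s $ j"
    and q: "q permutes {..<n}"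
  shows "num_codewords s (perm_mat n q *\<^sub>v s) w A =
    card {p. (p permutes {..<n} \<and> card {i\<in>{..<n}. p i \<noteq> q i} = w) \<and>
             theta A *\<^sub>v vec_of_mat (perm_mat n p) = 0\<^sub>v (dim_row (theta A))}"
proof -
  let ?c = "\<lambda>p. perm_mat n p *\<^sub>v s"
  let ?P = "{p. (p permutes {..<n} \<and> card {i\<in>{..<n}. p i \<noteq> q i} = w) \<and>
             theta A *\<^sub>v vec_of_mat (perm_mat n p) = 0\<^sub>v (dim_row (theta A))}"
  have bound: "p i < n" if "p permutes {..<n}" "i < n" for p i
    using permutes_in_image[OF that(1), of i] that(2) by simp
  have eq_iff: "?c p $ i = ?c p' $ i \<longleftrightarrow> p i = p' i"
    if p: "p permutes {..<n}" "p' permutes {..<n}" "i < n" for p p' i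
  proof -
    have "?c p $ i = s $ p i" "?c p' $ i = s $ p' i"
      using p by (simp_all add: perm_mat_mult_vec[OF _ s])
    then show ?thesis
      using distinct bound[OF p(1,3)] bound[OF p(2,3)] by metis
  qed
  have weight: "hamming_weight (?c q) (?c p) = card {i\<in>{..<n}. p i \<noteq> q i}"
    if "p permutes {..<n}" for p
    unfolding hamming_weight_def
    by (rule arg_cong[where f = card]) (use eq_iff[OF that q] in auto)
  let ?Q = "{p. p permutes {..<n} \<and>
             theta A *\<^sub>v vec_of_mat (perm_mat n p) = 0\<^sub>v (dim_row (theta A))}"
  have "perm_code (theta A) s = ?c ` ?Q"
    using s by (auto simp: perm_code_def perm_mats_eq)
  then have "{x \<in> perm_code (theta A) s. hamming_weight (?c q) x = w} =
      ?c ` {p \<in> ?Q. hamming_weight (?c q) (?c p) = w}"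
    by (simp only: Compr_image_eq)
  also have "{p \<in> ?Q. hamming_weight (?c q) (?c p) = w} = ?P"
    using weight by (intro Collect_cong) auto
  finally have "{x \<in> perm_code (theta A) s. hamming_weight (?c q) x = w} = ?c ` ?P" .
  moreover have "inj_on ?c ?P"
  proof (rule inj_onI)
    fix p p' assume "p \<in> ?P" "p' \<in> ?P" "?c p = ?c p'"
    then have pp: "p permutes {..<n}" "p' permutes {..<n}" "?c p = ?c p'" by auto
    show "p = p'"
    proof
      fix i show "p i = p' i"
        using eq_iff[OF pp(1,2), of i] pp(3) permutes_not_in[OF pp(1), of i]
          permutes_not_in[OF pp(2), of i] by (cases "i < n") simp_all
    qed
  qed
  ultimately show ?thesis by (simp add: num_codewords_def card_image)
qed

section \<open>Averaging the weight distribution over the random matrix\<close>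

theorem lemma5:
  fixes n m w :: nat and s orig :: "real vec"
  assumes "n \<ge> 2" and "m \<ge> 1"
    and "s \<in> carrier_vec n"
    and "\<forall>i<n. \<forall>j<n. i \<noteq> j \<longrightarrow> s $ i \<noteq> s $ j"
    and "orig \<in> perm_vecs s"
    and "w \<in> {1..n}"
  shows "measure_pmf.expectation (pmf_of_set (two_ones_mats m (n\<^sup>2)))
           (\<lambda>A. real (num_codewords s orig w A)) =
         real (n choose w) * real_of_int \<lfloor>(fact w + 1) / exp (1::real)\<rfloor> *
         ((real (n choose 2) + real ((n\<^sup>2 - n) choose 2)) / real (n\<^sup>2 choose 2)) ^ m"
proof -
  let ?S = "two_ones_mats m (n\<^sup>2)"
  obtain q where q: "q permutes {..<n}" and orig: "orig = perm_mat n q *\<^sub>v s"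
    using assms(3,5) by (auto simp: perm_vecs_def perm_mats_eq)
  let ?W = "{p. p permutes {..<n} \<and> card {i\<in>{..<n}. p i \<noteq> q i} = w}"
  let ?good = "\<lambda>A p. theta A *\<^sub>v vec_of_mat (perm_mat n p) = 0\<^sub>v (dim_row (theta A))"
  \<comment> \<open>At least two columns are needed for the sample space to be nonempty when m >= 1,
    so that \<open>pmf_of_set\<close> is the uniform distribution.\<close>
  have "n\<^sup>2 \<ge> 2" using assms(1) by (simp add: power2_eq_square mult_le_mono[of 2 n 1 n, simplified])
  then have "card ?S > 0" by (simp add: card_two_ones_mats zero_less_binomial)
  then have S: "finite ?S" "?S \<noteq> {}" using card_gt_0_iff by blast+
  have W: "finite ?W" by (rule finite_subset[OF _ finite_permutations[of "{..<n}"]]) auto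
  have count: "num_codewords s orig w A = card {p \<in> ?W. ?good A p}" for A
    using num_codewords_eq_card_permutes[OF assms(3,4) q] by (simp add: orig)
  \<comment> \<open>Writing the count as a sum of indicators over the fixed set \<open>?W\<close>
    permits exchanging the sums, which is linearity of expectation in counting form.\<close>
  have "(\<Sum>A\<in>?S. num_codewords s orig w A) = (\<Sum>A\<in>?S. \<Sum>p\<in>?W. if ?good A p then 1 else 0)"
    using W by (simp add: count sum.If_cases Int_def)
  also have "\<dots> = (\<Sum>p\<in>?W. \<Sum>A\<in>?S. if ?good A p then 1 else 0)"
    by (rule sum.swap)
  also have "\<dots> = (\<Sum>p\<in>?W. ((n choose 2) + ((n\<^sup>2 - n) choose 2)) ^ m)"
    using S(1) by (intro sum.cong refl) (simp add: sum.If_cases Int_def card_annihilating_mats)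
  also have "\<dots> = (n choose w) * card (derangements {..<w}) *
      ((n choose 2) + ((n\<^sup>2 - n) choose 2)) ^ m"
    using card_permutes_differing[OF _ q, of w] by simp
  finally have total: "(\<Sum>A\<in>?S. num_codewords s orig w A) = (n choose w) *
      card (derangements {..<w}) * ((n choose 2) + ((n\<^sup>2 - n) choose 2)) ^ m" .
  have "measure_pmf.expectation (pmf_of_set ?S) (\<lambda>A. real (num_codewords s orig w A)) =
      real (\<Sum>A\<in>?S. num_codewords s orig w A) / real (card ?S)"
    using S by (simp add: integral_pmf_of_set)
  also have "\<dots> = real (n choose w) * real (card (derangements {..<w})) *
      ((real (n choose 2) + real ((n\<^sup>2 - n) choose 2)) / real (n\<^sup>2 choose 2)) ^ m"
    by (simp add: total card_two_ones_mats power_divide)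
  also have "real (card (derangements {..<w})) = real_of_int \<lfloor>(fact w + 1) / exp (1::real)\<rfloor>"
    using card_derangements[of w] assms(6) by (metis atLeastAtMost_iff of_int_of_nat_eq)
  finally show ?thesis .
qed

end
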